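(* Let $d\ge 1$, let $\Omega_i\subseteq\mathbb{C}$ ($i=1,\ldots,d$) be simply connected domains and $\Omega=\prod_{i=1}^d\Omega_i$. Fix $\zeta^0\in\Omega$ and an infinite subset $\mu$ of $\mathbb{N}$. Then for every holomorphic function $f\in H(\Omega)$ there exists an enumeration $N''_j$, $j=0,1,2,\ldots$, of $\mathbb{N}^d$ such that $f$ is not universal with respect to the enumeration $N''_j$.
   Context: $\mathbb{N}=\{0,1,2,\ldots\}$. $H(\Omega)$ is the space of holomorphic functions on the open set $\Omega\subseteq\mathbb{C}^d$. For $a=(a_1,\ldots,a_d)\in\mathbb{N}^d$ and $\zeta=(\zeta_1,\ldots,\zeta_d)\in\Omega$, write $(z-\zeta)^a=(z_1-\zeta_1)^{a_1}\cdots(z_d-\zeta_d)^{a_d}$, and for $f\in H(\Omega)$ let $$a_{a}(f,\zeta)=\frac{1}{a_1!\cdots a_d!}\frac{\partial^{a_1+\cdots+a_d}f}{\partial z_1^{a_1}\cdots\partial z_d^{a_d}}(\zeta)$$ be the coefficient of $(z-\zeta)^a$ in the Taylor expansion of $f$ with center $\zeta$. Given an enumeration $(N_j)_{j\ge0}$ of $\mathbb{N}^d$, put $S_N(f,\zeta)(z)=\sum_{j=0}^N a_{N_j}(f,\zeta)(z-\zeta)^{N_j}$ for $N\in\mathbb{N}$. For a compact set $K\subset\mathbb{C}^d$, $A_D(K)$ is the set of all functions $f:K\to\mathbb{C}$ that are continuous on $K$ and such that, for every disc $D\subset\mathbb{C}$ and every holomorphic mapping $\varphi:D\to K\subset\mathbb{C}^d$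 (i.e. each coordinate of $\varphi$ is a complex-valued holomorphic function on $D$), the composition $f\circ\varphi:D\to\mathbb{C}$ is holomorphic. A function $f\in H(\Omega)$ is universal with respect to the enumeration $(N_j)$ if for every choice of compact sets $K_i\subseteq\mathbb{C}\setminus\Omega_i$ with $\mathbb{C}\setminus K_i$ connected ($i=1,\ldots,d$) and every $h\in A_D\left(\prod_{i=1}^dK_i\right)$, there exists a strictly increasing sequence $\lambda_n\in\mu$, $n=1,2,\ldots$, such that, as $n\to+\infty$, $S_{\lambda_n}(f,\zeta^0)\to h$ uniformly on $\prod_{i=1}^dK_i$ and $S_{\lambda_n}(f,\zeta^0)\to f$ uniformly on compact subsets of $\Omega$, where the partial sums $S_N$ are formed with the enumeration $(N_j)$.
   Formalization: Each Ω_i is additionally assumed to be different from ℂ; if some Ω_i = ℂ then K_i must be empty, the condition on h is vacuous, and f = 0 is universal with respect to every enumeration, so the claim fails. *)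

theory Defs
  imports "HOL-Complex_Analysis.Complex_Analysis"
begin

text \<open>
  Points of d-dimensional complex space are vectors of type \<open>complex^'d\<close>, multi-indices are
  vectors of type \<open>nat^'d\<close>. The index type is linearly ordered so that its elements
  play the role of \<open>1 < \<dots> < d\<close>; the order only fixes the order of iterated
  partial derivatives.
\<close>

definition cart_prod :: "('d::finite \<Rightarrow> complex set) \<Rightarrow> (complex^'d::finite) set" where
  "cart_prod A = {z. \<forall>i. z $ i \<in> A i}"

text \<open>Frechet differentiability with complex-linear derivative.\<close>

definition holomorphic_several :: "(complex^'d::finite \<Rightarrow> complex) \<Rightarrow> (complex^'d::finite) set \<Rightarrow> bool" where
  "holomorphic_several f S \<longleftrightarrow>
     (\<forall>z\<in>S. \<exists>f'. (f has_derivative f') (at z within S) \<and> (\<forall>c v. f' (c *s v) = c * f' v))"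

definition partial_deriv ::
  "'d::finite \<Rightarrow> (complex^'d::finite \<Rightarrow> complex) \<Rightarrow> complex^'d::finite \<Rightarrow> complex" where
  "partial_deriv i f z = deriv (\<lambda>w. f (\<chi> j. if j = i then w else z $ j)) (z $ i)"

definition mixed_deriv ::
  "nat^'d::{finite,linorder} \<Rightarrow> (complex^'d::{finite,linorder} \<Rightarrow> complex) \<Rightarrow> complex^'d::{finite,linorder} \<Rightarrow> complex" where
  "mixed_deriv a f = foldr (\<lambda>i. partial_deriv i ^^ (a $ i)) (sorted_list_of_set UNIV) f"

definition taylor_coeff ::
  "nat^'d::{finite,linorder} \<Rightarrow> (complex^'d::{finite,linorder} \<Rightarrow> complex) \<Rightarrow> complex^'d::{finite,linorder} \<Rightarrow> complex" where
  "taylor_coeff a f \<zeta> = mixed_deriv a f \<zeta> / (\<Prod>i\<in>UNIV. fact (a $ i))"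

definition multi_power :: "complex^'d::finite \<Rightarrow> nat^'d::finite \<Rightarrow> complex" where
  "multi_power z a = (\<Prod>i\<in>UNIV. (z $ i) ^ (a $ i))"

definition taylor_sum ::
  "(nat \<Rightarrow> nat^'d::{finite,linorder}) \<Rightarrow> nat \<Rightarrow> (complex^'d::{finite,linorder} \<Rightarrow> complex)
     \<Rightarrow> complex^'d::{finite,linorder} \<Rightarrow> complex^'d::{finite,linorder} \<Rightarrow> complex" where
  "taylor_sum N n f \<zeta> z = (\<Sum>j\<le>n. taylor_coeff (N j) f \<zeta> * multi_power (z - \<zeta>) (N j))"

text \<open>Functions on \<open>K\<close> are represented by total functions; their values off \<open>K\<close> are irrelevant.\<close>

definition A_D :: "(complex^'d::finite) set \<Rightarrow> (complex^'d::finite \<Rightarrow> complex) set" where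
  "A_D K = {h. continuous_on K h \<and>
     (\<forall>c r \<phi>. (\<forall>i. (\<lambda>w. \<phi> w $ i) holomorphic_on ball c r) \<and> \<phi> ` ball c r \<subseteq> K
        \<longrightarrow> (h \<circ> \<phi>) holomorphic_on ball c r)}"

definition universal_wrt ::
  "('d::{finite,linorder} \<Rightarrow> complex set) \<Rightarrow> complex^'d::{finite,linorder} \<Rightarrow> nat set \<Rightarrow> (nat \<Rightarrow> nat^'d::{finite,linorder})
     \<Rightarrow> (complex^'d::{finite,linorder} \<Rightarrow> complex) \<Rightarrow> bool" where
  "universal_wrt \<Omega> \<zeta> \<mu> N f \<longleftrightarrow>
     (\<forall>K. (\<forall>i. compact (K i) \<and> K i \<subseteq> - \<Omega> i \<and> connected (- K i)) \<longrightarrow>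
       (\<forall>h\<in>A_D (cart_prod K). \<exists>l. strict_mono l \<and> range l \<subseteq> \<mu> \<and>
          uniform_limit (cart_prod K) (\<lambda>n. taylor_sum N (l n) f \<zeta>) h sequentially \<and>
          (\<forall>L. compact L \<and> L \<subseteq> cart_prod \<Omega> \<longrightarrow>
             uniform_limit L (\<lambda>n. taylor_sum N (l n) f \<zeta>) f sequentially)))"

end

theory Submission
  imports Defs
begin

text \<open>
  Universality already fails on a product of singletons. Choose \<open>w\<^sub>i \<notin> \<Omega>\<^sub>i\<close> and
  \<open>K\<^sub>i = {w\<^sub>i}\<close>. Every function on the single point \<open>w\<close> belongs to
  \<open>A_D\<close>, so a universal \<open>f\<close> would have every complex number as a limit of a
  subsequence of its Taylor partial sums at \<open>w\<close>. Those sums are the partial sums of a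
  numerical series whose terms are indexed by the multi-indices, and the enumeration decides
  their order. It is therefore enough to show that every complex series can be
  rearranged so that some number is not a subsequential limit of its partial sums
  (\<open>rearrangement_omitting_a_limit\<close>).

  If the series converges absolutely, its partial sums have only one limit point. Otherwise,
  for one of \<open>u = 1, -1, \<i>, -\<i>\<close>, the positive parts of the real numbers
  \<open>Re (u * t n)\<close> have infinite sum. As in Riemann's rearrangement theorem, one can then
  spend enough positive terms before every other term to keep the partial sums of
  \<open>Re (u * t n)\<close> at \<open>1\<close> or above from some moment on
  (\<open>rearrangement_eventually_ge\<close>), and \<open>0\<close> is not a subsequential limit.
\<close>

section \<open>Rearranging a real series with divergent positive part\<close>

text \<open>
  The rearrangement is greedy: it takes the first unused term when that leaves the sum at
  least \<open>C\<close>, and otherwise the first unused positive term.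
\<close>

definition greedy_pick :: "(nat \<Rightarrow> real) \<Rightarrow> real \<Rightarrow> nat set \<Rightarrow> nat" where
  "greedy_pick g C U =
     (let a = (LEAST x. x \<notin> U)
      in if C \<le> sum g U + g a then a else (LEAST x. x \<notin> U \<and> 0 < g x))"

primrec greedy_used :: "(nat \<Rightarrow> real) \<Rightarrow> real \<Rightarrow> nat \<Rightarrow> nat set" where
  "greedy_used g C 0 = {}"
| "greedy_used g C (Suc n) = insert (greedy_pick g C (greedy_used g C n)) (greedy_used g C n)"

definition greedy :: "(nat \<Rightarrow> real) \<Rightarrow> real \<Rightarrow> nat \<Rightarrow> nat" where
  "greedy g C n = greedy_pick g C (greedy_used g C n)"

lemma greedy_used_eq: "greedy_used g C n = greedy g C ` {..<n}"
  by (induction n) (simp_all add: greedy_def lessThan_Suc)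

lemma finite_greedy_used: "finite (greedy_used g C n)"
  by (simp add: greedy_used_eq)

lemma ex_unused_positive:
  fixes g :: "nat \<Rightarrow> real"
  assumes "\<not> summable (\<lambda>n. max 0 (g n))" and "finite U"
  shows "\<exists>x. x \<notin> U \<and> 0 < g x"
proof (rule ccontr)
  assume "\<not> ?thesis"
  then have "max 0 (g x) = 0" if "x \<notin> U" for x
    using that by (auto simp: not_less)
  with assms show False
    using summable_finite[of U "\<lambda>n. max 0 (g n)"] by auto
qed

lemma greedy_not_used:
  assumes "\<not> summable (\<lambda>n. max 0 (g n))"
  shows "greedy g C n \<notin> greedy_used g C n"
proof -
  let ?U = "greedy_used g C n"
  have "(LEAST x. x \<notin> ?U) \<notin> ?U"
    using ex_new_if_finite[OF infinite_UNIV_nat finite_greedy_used[of g C n]]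
    by (rule LeastI_ex)
  moreover have "(LEAST x. x \<notin> ?U \<and> 0 < g x) \<notin> ?U"
    using LeastI_ex[OF ex_unused_positive[OF assms finite_greedy_used[of g C n]]] by blast
  ultimately show ?thesis
    by (simp add: greedy_def greedy_pick_def Let_def)
qed

lemma inj_greedy:
  assumes "\<not> summable (\<lambda>n. max 0 (g n))"
  shows "inj (greedy g C)"
proof (rule linorder_injI)
  fix m n :: nat
  assume "m < n"
  then have "greedy g C m \<in> greedy_used g C n"
    by (simp add: greedy_used_eq)
  with greedy_not_used[OF assms] show "greedy g C m \<noteq> greedy g C n"
    by metis
qed

lemma sum_greedy_used:
  assumes "\<not> summable (\<lambda>n. max 0 (g n))"
  shows "sum g (greedy_used g C n) = (\<Sum>j<n. g (greedy g C j))"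
  unfolding greedy_used_eq
  by (simp add: sum.reindex inj_on_subset[OF inj_greedy[OF assms]])

text \<open>
  Only finitely many values can be preferred to \<open>a\<close>, namely smaller ones, and each of
  them only until it is used, so the turn of \<open>a\<close> comes.
\<close>

lemma least_unused_chosen:
  fixes p :: "nat \<Rightarrow> nat"
  assumes "\<And>n. m \<le> n \<Longrightarrow> p n = (LEAST x. x \<notin> p ` {..<n} \<and> P x)" and "P a"
  shows "a \<in> range p"
  using \<open>P a\<close>
proof (induction a rule: less_induct)
  case (less a)
  have "finite {b. b < a \<and> P b}" by simp
  moreover have "{b. b < a \<and> P b} \<subseteq> range p"
    using less.IH by blast
  ultimately obtain J where J: "finite J" "{b. b < a \<and> P b} = p ` J"
    by (meson finite_subset_image)
  obtain k where k: "J \<subseteq> {..<k}"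
    using J(1) finite_nat_iff_bounded by blast
  define n where "n = max m k"
  show ?case
  proof (rule ccontr)
    assume a: "a \<notin> range p"
    have "(LEAST x. x \<notin> p ` {..<n} \<and> P x) = a"
    proof (rule Least_equality)
      show "a \<notin> p ` {..<n} \<and> P a" using a less.prems by blast
    next
      fix y assume y: "y \<notin> p ` {..<n} \<and> P y"
      show "a \<le> y"
      proof (rule ccontr)
        assume "\<not> a \<le> y"
        with y have "y \<in> p ` J" using J(2) by auto
        with k have "y \<in> p ` {..<n}" by (auto simp: n_def)
        with y show False by blast
      qed
    qed
    with assms(1)[of n] have "p n = a" by (simp add: n_def)
    with a show False by blast
  qed
qed

text \<open>
  If only positive terms were chosen from some step on, all of them would be, and the
  divergence of their sum would drive the partial sums past any bound.
\<close>

lemma greedy_positive_steps_unbounded: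
  assumes div: "\<not> summable (\<lambda>n. max 0 (g n))"
    and step: "\<And>n. m \<le> n \<Longrightarrow>
       greedy g C n = (LEAST x. x \<notin> greedy_used g C n \<and> 0 < g x)"
  shows "\<exists>n\<ge>m. B < sum g (greedy_used g C n)"
proof (rule ccontr)
  assume "\<not> ?thesis"
  then have bound: "sum g (greedy_used g C n) \<le> B" if "m \<le> n" for n
    using that by (meson not_less)
  let ?p = "greedy g C"
  have pos: "0 < g (?p n)" if "m \<le> n" for n
    using LeastI_ex[OF ex_unused_positive[OF div finite_greedy_used[of g C n]]]
    unfolding step[OF that] by blast
  have range: "a \<in> range ?p" if "0 < g a" for a
    using least_unused_chosen[of m ?p "\<lambda>x. 0 < g x"] step that
    by (simp add: greedy_used_eq)
  have "summable (\<lambda>j. max 0 (g (?p j)))"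
  proof (rule summableI_nonneg_bounded)
    show "0 \<le> max 0 (g (?p j))" for j by simp
    \<comment> \<open>Positive parts and terms differ only at negative terms, which occur only before step \<open>m\<close>.\<close>
    show "(\<Sum>j<n. max 0 (g (?p j))) \<le> B + (\<Sum>j<m. max 0 (g (?p j)) - g (?p j))" for n
    proof -
      let ?k = "max m n"
      have "(\<Sum>j<n. max 0 (g (?p j))) \<le> (\<Sum>j<?k. max 0 (g (?p j)))"
        by (rule sum_mono2) auto
      also have "\<dots> = (\<Sum>j<?k. g (?p j)) + (\<Sum>j<?k. max 0 (g (?p j)) - g (?p j))"
        by (simp add: sum_subtractf)
      also have "(\<Sum>j<?k. max 0 (g (?p j)) - g (?p j)) = (\<Sum>j<m. max 0 (g (?p j)) - g (?p j))"
        using pos by (intro sum.mono_neutral_right) (auto simp: not_less less_imp_le max_def)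
      also have "(\<Sum>j<?k. g (?p j)) \<le> B"
        using bound[of ?k] by (simp add: sum_greedy_used[OF div])
      finally show ?thesis by simp
    qed
  qed
  then have "((\<lambda>x. max 0 (g x)) \<circ> ?p) summable_on UNIV"
    by (subst summable_on_UNIV_nonneg_real_iff) (simp_all add: o_def)
  then have "(\<lambda>x. max 0 (g x)) summable_on range ?p"
    by (subst summable_on_reindex[OF inj_greedy[OF div]])
  also have "?this \<longleftrightarrow> (\<lambda>x. max 0 (g x)) summable_on UNIV"
  proof (rule summable_on_cong_neutral)
    show "max 0 (g x) = 0" if "x \<in> UNIV - range ?p" for x
      using range[of x] that by (auto simp: max_def)
  qed auto
  finally have "(\<lambda>x. max 0 (g x)) summable_on UNIV" .
  with div show False
    by (simp add: summable_on_UNIV_nonneg_real_iff)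
qed

lemma greedy_cases:
  obtains "greedy g C n = (LEAST x. x \<notin> greedy_used g C n)"
    "C \<le> sum g (greedy_used g C n) + g (LEAST x. x \<notin> greedy_used g C n)"
  | "greedy g C n = (LEAST x. x \<notin> greedy_used g C n \<and> 0 < g x)"
    "sum g (greedy_used g C n) + g (LEAST x. x \<notin> greedy_used g C n) < C"
proof (cases "C \<le> sum g (greedy_used g C n) + g (LEAST x. x \<notin> greedy_used g C n)")
  case True
  then show ?thesis using that(1) by (simp add: greedy_def greedy_pick_def)
next
  case False
  then show ?thesis using that(2) by (simp add: greedy_def greedy_pick_def)
qed

lemma sum_greedy_used_Suc:
  assumes "\<not> summable (\<lambda>n. max 0 (g n))"
  shows "sum g (greedy_used g C (Suc n)) = sum g (greedy_used g C n) + g (greedy g C n)"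
  by (simp only: sum_greedy_used[OF assms] sum.lessThan_Suc)

text \<open>
  The least term never chosen would, from some step on, be the first unused one and be
  refused each time. So the partial sums would stay bounded while only positive terms are chosen.
\<close>

lemma surj_greedy:
  assumes div: "\<not> summable (\<lambda>n. max 0 (g n))"
  shows "surj (greedy g C)"
proof (rule ccontr)
  let ?p = "greedy g C" and ?U = "greedy_used g C"
  assume "\<not> surj ?p"
  then have ex: "\<exists>a. a \<notin> range ?p" by blast
  define a where "a = (LEAST a. a \<notin> range ?p)"
  have a: "a \<notin> range ?p" unfolding a_def using ex by (rule LeastI_ex)
  have "{..<a} \<subseteq> range ?p"
    using not_less_Least[of _ "\<lambda>a. a \<notin> range ?p"] unfolding a_def by blast
  then obtain J where J: "finite J" "{..<a} = ?p ` J"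
    by (meson finite_lessThan finite_subset_image)
  obtain m where m: "J \<subseteq> {..<m}"
    using J(1) finite_nat_iff_bounded by blast
  \<comment> \<open>From step \<open>m\<close> on the first unused term is \<open>a\<close>, and it is always refused.\<close>
  have least: "(LEAST x. x \<notin> ?U n) = a" if "m \<le> n" for n
  proof (rule Least_equality)
    show "a \<notin> ?U n" using a by (auto simp: greedy_used_eq)
    have "{..<a} \<subseteq> ?U n"
      using J(2) m that by (auto simp: greedy_used_eq)
    then show "a \<le> y" if "y \<notin> ?U n" for y
      using that by (meson lessThan_iff not_less subsetD)
  qed
  have refused: "?p n = (LEAST x. x \<notin> ?U n \<and> 0 < g x) \<and> sum g (?U n) + g a < C" if "m \<le> n" for n
  proof (cases rule: greedy_cases[where g = g and C = C and n = n])
    case 1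
    with least[OF that] have "?p n = a" by simp
    with a show ?thesis by blast
  next
    case 2
    with least[OF that] show ?thesis by simp
  qed
  then obtain n where "m \<le> n" "C - g a < sum g (?U n)"
    using greedy_positive_steps_unbounded[OF div, of m C "C - g a"] by blast
  with refused[of n] show False by linarith
qed

text \<open>
  Once the sum has reached \<open>C\<close> it never falls below again. It does reach \<open>C\<close>,
  because below \<open>C\<close> every choice other than a positive term ends at \<open>C\<close> or above.
\<close>

lemma sum_greedy_eventually_ge:
  assumes div: "\<not> summable (\<lambda>n. max 0 (g n))"
  shows "\<forall>\<^sub>F n in sequentially. C \<le> (\<Sum>j<n. g (greedy g C j))"
proof -
  let ?p = "greedy g C" and ?U = "greedy_used g C"
  have "\<exists>m. C \<le> sum g (?U m)"
  proof (rule ccontr)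
    assume "\<not> ?thesis"
    then have below: "sum g (?U n) < C" for n by (meson not_less)
    have "?p n = (LEAST x. x \<notin> ?U n \<and> 0 < g x)" for n
    proof (cases rule: greedy_cases[where g = g and C = C and n = n])
      case 1
      then have "C \<le> sum g (?U (Suc n))"
        unfolding sum_greedy_used_Suc[OF div] by simp
      with below[of "Suc n"] show ?thesis by linarith
    next
      case 2
      then show ?thesis by simp
    qed
    then obtain n where "C < sum g (?U n)"
      using greedy_positive_steps_unbounded[OF div, of 0 C C] by blast
    with below[of n] show False by linarith
  qed
  then obtain m where m: "C \<le> sum g (?U m)" by blast
  have "C \<le> sum g (?U n)" if "m \<le> n" for n
    using that
  proof (induction n rule: dec_induct)
    case base
    show ?case by (rule m)
  next
    case (step n)
    show ?case
    proof (cases rule: greedy_cases[where g = g and C = C and n = n])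
      case 1
      then show ?thesis unfolding sum_greedy_used_Suc[OF div] by simp
    next
      case 2
      have "0 < g (?p n)"
        using LeastI_ex[OF ex_unused_positive[OF div finite_greedy_used[of g C n]]]
        unfolding 2(1) by blast
      with step.IH show ?thesis unfolding sum_greedy_used_Suc[OF div] by simp
    qed
  qed
  then show ?thesis
    unfolding sum_greedy_used[OF div] eventually_sequentially by blast
qed

lemma rearrangement_eventually_ge:
  fixes g :: "nat \<Rightarrow> real"
  assumes "\<not> summable (\<lambda>n. max 0 (g n))"
  obtains p :: "nat \<Rightarrow> nat" where "bij p" "\<forall>\<^sub>F n in sequentially. C \<le> (\<Sum>j\<le>n. g (p j))"
proof
  show "bij (greedy g C)"
    using inj_greedy[OF assms] surj_greedy[OF assms] by (rule bijI)
  show "\<forall>\<^sub>F n in sequentially. C \<le> (\<Sum>j\<le>n. g (greedy g C j))"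
    using sequentially_offset[OF sum_greedy_eventually_ge[OF assms, of C], of 1]
    by (simp add: lessThan_Suc_atMost)
qed

section \<open>Subsequential limits of a rearranged complex series\<close>

text \<open>
  The norm of a complex number is at most the sum of the positive parts of its components in
  the four directions \<open>1, -1, \<i>, -\<i>\<close>.
\<close>

lemma nonsummable_direction:
  fixes t :: "nat \<Rightarrow> complex"
  assumes "\<not> summable (\<lambda>n. norm (t n))"
  obtains u where "\<not> summable (\<lambda>n. max 0 (Re (u * t n)))"
proof (rule ccontr)
  assume "\<not> thesis"
  with that have s: "summable (\<lambda>n. max 0 (Re (u * t n)))" for u by blast
  have "summable (\<lambda>n. (max 0 (Re (1 * t n)) + max 0 (Re ((-1) * t n)))
      + (max 0 (Re (\<i> * t n)) + max 0 (Re ((-\<i>) * t n))))"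
    by (intro summable_add s)
  then have "summable (\<lambda>n. norm (t n))"
  proof (rule summable_comparison_test'[where N = 0])
    fix n
    have "norm (t n) \<le> \<bar>Re (t n)\<bar> + \<bar>Im (t n)\<bar>" by (rule cmod_le)
    then show "norm (norm (t n)) \<le> (max 0 (Re (1 * t n)) + max 0 (Re ((-1) * t n)))
      + (max 0 (Re (\<i> * t n)) + max 0 (Re ((-\<i>) * t n)))"
      by (auto simp: max_def)
  qed
  with assms show False by blast
qed

lemma rearrangement_omitting_a_limit:
  fixes t :: "nat \<Rightarrow> complex"
  obtains p :: "nat \<Rightarrow> nat" and c where "bij p"
    "\<forall>l. strict_mono l \<longrightarrow> \<not> (\<lambda>n. \<Sum>j\<le>l n. t (p j)) \<longlonglongrightarrow> c"
proof (cases "summable (\<lambda>n. norm (t n))")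
  case True
  then have lim: "(\<lambda>n. \<Sum>j\<le>n. t j) \<longlonglongrightarrow> suminf t"
    by (rule summable_LIMSEQ'[OF summable_norm_cancel])
  show ?thesis
  proof (rule that)
    show "bij id" by (rule bij_id)
    show "\<forall>l. strict_mono l \<longrightarrow> \<not> (\<lambda>n. \<Sum>j\<le>l n. t (id j)) \<longlonglongrightarrow> suminf t + 1"
    proof (intro allI impI notI)
      fix l :: "nat \<Rightarrow> nat"
      assume l: "strict_mono l"
      assume "(\<lambda>n. \<Sum>j\<le>l n. t (id j)) \<longlonglongrightarrow> suminf t + 1"
      moreover have "(\<lambda>n. \<Sum>j\<le>l n. t (id j)) \<longlonglongrightarrow> suminf t"
        using LIMSEQ_subseq_LIMSEQ[OF lim l] by (simp add: o_def)
      ultimately have "suminf t + 1 = suminf t" by (rule LIMSEQ_unique)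
      then show False by simp
    qed
  qed
next
  case False
  then obtain u where u: "\<not> summable (\<lambda>n. max 0 (Re (u * t n)))"
    by (rule nonsummable_direction)
  obtain p where p: "bij p" and ge: "\<forall>\<^sub>F n in sequentially. 1 \<le> (\<Sum>j\<le>n. Re (u * t (p j)))"
    by (rule rearrangement_eventually_ge[OF u])
  show ?thesis
  proof (rule that)
    show "bij p" by (rule p)
    show "\<forall>l. strict_mono l \<longrightarrow> \<not> (\<lambda>n. \<Sum>j\<le>l n. t (p j)) \<longlonglongrightarrow> 0"
    proof (intro allI impI notI)
      fix l :: "nat \<Rightarrow> nat"
      assume l: "strict_mono l"
      assume "(\<lambda>n. \<Sum>j\<le>l n. t (p j)) \<longlonglongrightarrow> 0"
      then have "(\<lambda>n. Re (u * (\<Sum>j\<le>l n. t (p j)))) \<longlonglongrightarrow> Re (u * 0)"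
        by (intro tendsto_intros)
      then have "(\<lambda>n. \<Sum>j\<le>l n. Re (u * t (p j))) \<longlonglongrightarrow> 0"
        by (simp add: sum_distrib_left Re_sum del: times_complex.sel)
      moreover have "\<forall>\<^sub>F n in sequentially. 1 \<le> (\<Sum>j\<le>l n. Re (u * t (p j)))"
        using ge l by (rule eventually_subseq[rotated])
      ultimately have "1 \<le> (0::real)"
        by (intro tendsto_lowerbound) auto
      then show False by simp
    qed
  qed
qed

section \<open>Failure of universality at a single point\<close>

lemma A_D_singleton: "h \<in> A_D {w}"
proof -
  have "(h \<circ> \<phi>) holomorphic_on ball c r" if "\<phi> ` ball c r \<subseteq> {w}" for \<phi> and c :: complex and r
  proof (rule holomorphic_transform[OF holomorphic_on_const])
    fix x assume "x \<in> ball c r"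
    with that have "\<phi> x \<in> {w}" by blast
    then show "h w = (h \<circ> \<phi>) x" by simp
  qed
  then show ?thesis by (simp add: A_D_def)
qed

lemma cart_prod_singletons:
  fixes w :: "complex^'d::finite"
  shows "cart_prod (\<lambda>i. {w $ i}) = {w}"
  by (auto simp: cart_prod_def vec_eq_iff)

text \<open>
  Approximation of the constant \<open>c\<close> on the product of the singletons
  \<open>{w $ i}\<close>, whose complements are connected.
\<close>

lemma universal_wrt_point_limit:
  fixes w :: "complex^'d::{finite,linorder}"
  assumes "universal_wrt \<Omega> \<zeta> \<mu> N f" and "\<And>i. w $ i \<notin> \<Omega> i"
  obtains l where "strict_mono l" "(\<lambda>n. taylor_sum N (l n) f \<zeta> w) \<longlonglongrightarrow> c"
proof -
  have "connected (- {w $ i})" for i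
    by (simp add: connected_punctured_universe)
  then have "\<forall>i. compact {w $ i} \<and> {w $ i} \<subseteq> - \<Omega> i \<and> connected (- {w $ i})"
    using assms(2) by simp
  moreover have "(\<lambda>_. c) \<in> A_D (cart_prod (\<lambda>i. {w $ i}))"
    unfolding cart_prod_singletons by (rule A_D_singleton)
  ultimately obtain l where "strict_mono l"
    "uniform_limit (cart_prod (\<lambda>i. {w $ i})) (\<lambda>n. taylor_sum N (l n) f \<zeta>) (\<lambda>_. c) sequentially"
    using assms(1)[unfolded universal_wrt_def, rule_format, of "\<lambda>i. {w $ i}" "\<lambda>_. c"] by blast
  with that show thesis
    by (simp add: cart_prod_singletons)
qed

lemma enumeration_of_multi_indices:
  obtains e :: "nat \<Rightarrow> nat^'d::finite" where "bij e"
proof -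
  have "inj (\<lambda>n. (\<chi> i. n) :: nat^'d)"
    by (auto simp: inj_def vec_eq_iff)
  then have "infinite (UNIV :: (nat^'d) set)"
    using range_inj_infinite infinite_super[OF subset_UNIV] by blast
  from bij_betw_from_nat_into[OF countableI_type this] show thesis
    by (rule that)
qed

theorem theorem6p1:
  fixes \<Omega> :: "'d::{finite,linorder} \<Rightarrow> complex set"
    and \<zeta> :: "complex^'d::{finite,linorder}" and \<mu> :: "nat set" and f :: "complex^'d::{finite,linorder} \<Rightarrow> complex"
  assumes "\<And>i. open (\<Omega> i)" and "\<And>i. connected (\<Omega> i)" and "\<And>i. simply_connected (\<Omega> i)"
    and "\<And>i. \<Omega> i \<noteq> UNIV"
    and "\<zeta> \<in> cart_prod \<Omega>"
    and "infinite \<mu>"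
    and "holomorphic_several f (cart_prod \<Omega>)"
  shows "\<exists>N :: nat \<Rightarrow> nat^'d::{finite,linorder}. bij N \<and> \<not> universal_wrt \<Omega> \<zeta> \<mu> N f"
proof -
  have "\<forall>i. \<exists>x. x \<notin> \<Omega> i" using assms(4) by blast
  then obtain v where v: "\<And>i. v i \<notin> \<Omega> i" by metis
  define w :: "complex^'d::{finite,linorder}" where "w = (\<chi> i. v i)"
  have w: "w $ i \<notin> \<Omega> i" for i using v by (simp add: w_def)
  obtain e :: "nat \<Rightarrow> nat^'d::{finite,linorder}" where e: "bij e" by (rule enumeration_of_multi_indices)
  obtain p :: "nat \<Rightarrow> nat" and c where p: "bij p" and omit: "\<forall>l. strict_mono l \<longrightarrow>
      \<not> (\<lambda>n. \<Sum>j\<le>l n. taylor_coeff (e (p j)) f \<zeta> * multi_power (w - \<zeta>) (e (p j))) \<longlonglongrightarrow> c"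
    by (rule rearrangement_omitting_a_limit
      [of "\<lambda>j. taylor_coeff (e j) f \<zeta> * multi_power (w - \<zeta>) (e j)"])
  have "\<not> universal_wrt \<Omega> \<zeta> \<mu> (e \<circ> p) f"
  proof
    assume "universal_wrt \<Omega> \<zeta> \<mu> (e \<circ> p) f"
    from universal_wrt_point_limit[OF this w, of c] obtain l
      where "strict_mono l" "(\<lambda>n. taylor_sum (e \<circ> p) (l n) f \<zeta> w) \<longlonglongrightarrow> c" .
    with omit show False by (simp add: taylor_sum_def)
  qed
  with bij_comp[OF p e] show ?thesis by blast
qed

end
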